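(* Let $N\ge2$, $1\le p<\infty$, $0<s<1$, and $$\frac{1}{1-s}\left(2-\frac1p\right)<r<\infty.$$ Let $a,b\in\mathbb{R}$ with $a<b$ and let $\varnothing\ne V\subset\mathbb{R}^{N-1}$ be bounded and open. Define $U=V\times(a,b)\subset\mathbb{R}^N$, and let $\sigma:U\to(0,1/2)$ be given by $$\sigma(x)=\frac12\left(\frac{x_N-a}{b-a}\right)^r.$$ Then $$\dot{W}^{s,p}(U)\subsetneqq\tilde{W}^{s,p}_{(\sigma)}(U).$$
   Context: Points are written $x=(x',x_N)\in\mathbb{R}^{N-1}\times\mathbb{R}$. For $U\subseteq\mathbb{R}^N$ open, $0<s<1$, $1\le p<\infty$, and a lower semicontinuous $\sigma:U\to(0,\infty]$ (a screening function): $\dot{W}^{s,p}(U)$ is the space of $f\in L^1_{\mathrm{loc}}(U)$ with $\int_U\int_U\frac{|f(y)-f(x)|^p}{|y-x|^{sp+N}}\,dy\,dx<\infty$, and $\tilde{W}^{s,p}_{(\sigma)}(U)$ is the space of $f\in L^1_{\mathrm{loc}}(U)$ with $\int_U\int_{B(x,\sigma(x))\cap U}\frac{|f(y)-f(x)|^p}{|y-x|^{sp+N}}\,dy\,dx<\infty$, where $B(x,r)$ is the open ball of center $x$ and radius $r$ (with $B(x,\infty)=\mathbb{R}^N$). *)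

theory Defs
  imports "HOL-Analysis.Analysis"
begin

definition locally_integrable :: "'a::euclidean_space set \<Rightarrow> ('a \<Rightarrow> real) \<Rightarrow> bool" where
  "locally_integrable U f \<longleftrightarrow> (\<forall>K. compact K \<and> K \<subseteq> U \<longrightarrow> f absolutely_integrable_on K)"

(* Points x = y contribute 0 here (division by zero); they form a null set. *)
definition gagliardo_kernel ::
    "real \<Rightarrow> real \<Rightarrow> ('a::euclidean_space \<Rightarrow> real) \<Rightarrow> 'a \<Rightarrow> 'a \<Rightarrow> real" where
  "gagliardo_kernel s p f x y =
     \<bar>f y - f x\<bar> powr p / norm (y - x) powr (s * p + real DIM('a))"

(* The radius is extended so that a screening function may take the value infinity,
   in which case the ball is the whole space. *)
definition eball :: "'a::metric_space \<Rightarrow> ereal \<Rightarrow> 'a set" where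
  "eball x \<rho> = {y. ereal (dist x y) < \<rho>}"

(* In both spaces below, functions on U are represented by total functions whose values
   off U are irrelevant, and functions equal a.e. on U are not identified; membership
   depends only on the a.e. class on U. *)
definition homogeneous_sobolev ::
    "real \<Rightarrow> real \<Rightarrow> 'a::euclidean_space set \<Rightarrow> ('a \<Rightarrow> real) set" where
  "homogeneous_sobolev s p U =
     {f. locally_integrable U f \<and>
         (\<integral>\<^sup>+x\<in>U. (\<integral>\<^sup>+y\<in>U. ennreal (gagliardo_kernel s p f x y) \<partial>lebesgue) \<partial>lebesgue) < \<infinity>}"

definition screened_sobolev ::
    "real \<Rightarrow> real \<Rightarrow> ('a \<Rightarrow> ereal) \<Rightarrow> 'a::euclidean_space set \<Rightarrow> ('a \<Rightarrow> real) set" where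
  "screened_sobolev s p \<sigma> U =
     {f. locally_integrable U f \<and>
         (\<integral>\<^sup>+x\<in>U. (\<integral>\<^sup>+y\<in>eball x (\<sigma> x) \<inter> U. ennreal (gagliardo_kernel s p f x y) \<partial>lebesgue) \<partial>lebesgue) < \<infinity>}"

end

theory Submission
  imports Defs
begin

text \<open>
  The function $f(x) = (x_N - a)^{-\beta}$ separates the two spaces when $\beta$ is slightly below
  $1/p$, namely $\max(0, 1/p - s) < \beta < 1/p$. Since $(\beta + s)p > 1$, the pairs $x$, $y$ at mutual
  distance comparable to $\delta$ and at height comparable to $\delta$ above the bottom face contribute
  $\delta^{1 - (\beta + s)p}$ to the unscreened energy, which is unbounded as $\delta \to 0$.
  In the screened energy the mean value theorem bounds the inner integral by a multiple of
  $(x_N - a)^{-(\beta + 1)p} \sigma(x)^{p(1 - s)}$, which $r(1 - s) > 1$ makes at most a multiple of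
  the integrable function $(x_N - a)^{-\beta p}$. If $b - a$ is small, the screening ball of a point
  high up may reach the bottom face; these pairs are at distance bounded below, and
  $f \in L^p(U)$ controls them, which is why $\beta < 1/p$ is needed.
\<close>

section \<open>Integrals of powers by dyadic decomposition\<close>

lemma dyadic_layer:
  fixes t \<rho> :: real
  assumes "0 < t" "t < \<rho>"
  obtains k :: nat where "\<rho> * 2 powr (- real k) / 2 \<le> t" "t < \<rho> * 2 powr (- real k)"
proof -
  define u where "u = log 2 (\<rho> / t)"
  have "u > 0" using assms by (simp add: u_def)
  have \<rho>: "\<rho> = t * 2 powr u" using assms by (simp add: u_def)
  \<comment> \<open>The largest integer strictly below \<open>u\<close>, so that the upper bound on
    \<open>t\<close> comes out strict; it is nonnegative because \<open>u > 0\<close>.\<close>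
  define k where "k = nat (\<lceil>u\<rceil> - 1)"
  have k: "real k < u" "u \<le> real k + 1"
    using \<open>u > 0\<close> unfolding k_def by linarith+
  show thesis
  proof
    have "2 powr (u - real k) \<le> 2 powr (1::real)"
      using k by (intro powr_mono) auto
    then show "\<rho> * 2 powr (- real k) / 2 \<le> t"
      using assms by (simp add: \<rho> powr_diff powr_minus field_simps)
    have "2 powr (0::real) < 2 powr (u - real k)"
      using k by (intro powr_less_mono) auto
    then show "t < \<rho> * 2 powr (- real k)"
      using assms by (simp add: \<rho> powr_diff powr_minus field_simps)
  qed
qed

text \<open>Freezes a power at the top \<open>h\<close> of a dyadic layer. The absolute value in the
  constant treats increasing and decreasing powers at once.\<close>

lemma powr_le_comparable:
  fixes t h e :: real
  assumes "0 < h" "h / 2 \<le> t" "t \<le> h"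
  shows "t powr e \<le> 2 powr \<bar>e\<bar> * h powr e"
proof (cases "e \<ge> 0")
  case True
  have "t powr e \<le> 1 * h powr e" using assms True by (simp add: powr_mono2)
  also have "\<dots> \<le> 2 powr \<bar>e\<bar> * h powr e"
    by (intro mult_right_mono) (auto simp: ge_one_powr_ge_zero)
  finally show ?thesis .
next
  case False
  have "t powr e \<le> (h / 2) powr e" using assms False by (intro powr_mono2') auto
  also have "\<dots> = 2 powr \<bar>e\<bar> * h powr e"
    using assms False by (simp add: powr_divide powr_minus field_simps)
  finally show ?thesis .
qed

text \<open>On the dyadic layer below \<open>h k\<close> the integrand is comparable to
  \<open>h k powr (\<gamma> - d)\<close> and the measure is at most \<open>C * h k powr d\<close>.
  The layer thus contributes a multiple of \<open>h k powr \<gamma>\<close>, and these form a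
  geometric series of ratio \<open>2 powr - \<gamma>\<close>. It is applied with \<open>w\<close>
  the distance to a point (\<open>d\<close> the dimension) and with \<open>w\<close> the height
  above the bottom face (\<open>d = 1\<close>).\<close>

lemma nn_integral_powr_le:
  fixes w :: "'a \<Rightarrow> real" and \<gamma> d \<rho> C :: real
  assumes w[measurable]: "w \<in> borel_measurable M" and S[measurable]: "S \<in> sets M"
    and "0 < \<gamma>" "0 < \<rho>" "0 \<le> C"
    and vol: "\<And>h. 0 < h \<Longrightarrow> emeasure M {x \<in> S. 0 < w x \<and> w x < h} \<le> ennreal (C * h powr d)"
  shows "(\<integral>\<^sup>+x\<in>{x \<in> S. 0 < w x \<and> w x < \<rho>}. ennreal (w x powr (\<gamma> - d)) \<partial>M)
      \<le> ennreal (2 powr \<bar>\<gamma> - d\<bar> / (1 - 2 powr - \<gamma>) * C * \<rho> powr \<gamma>)"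
proof -
  define A where "A h = {x \<in> S. 0 < w x \<and> w x < h}" for h
  have A[measurable]: "A h \<in> sets M" for h
  proof -
    have "A h = {x \<in> space M. x \<in> S \<and> 0 < w x \<and> w x < h}"
      using sets.sets_into_space[OF S] by (auto simp: A_def)
    then show ?thesis by simp
  qed
  define h where "h k = \<rho> * 2 powr (- real k)" for k :: nat
  have h: "h k > 0" for k using \<open>0 < \<rho>\<close> by (simp add: h_def)
  define c where "c = 2 powr \<bar>\<gamma> - d\<bar>"
  have c: "c > 0" by (simp add: c_def)
  have q: "2 powr - \<gamma> < (1::real)" using \<open>0 < \<gamma>\<close> by (simp add: powr_less_one)
  \<comment> \<open>The sum runs over the nested sets \<open>A (h k)\<close> instead of the disjoint
    layers. The overcounting costs nothing, since the measure bound is stated for these sets, and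
    one term already dominates the integrand at each point.\<close>
  have "(\<integral>\<^sup>+x\<in>A \<rho>. ennreal (w x powr (\<gamma> - d)) \<partial>M)
      \<le> (\<integral>\<^sup>+x. (\<Sum>k. ennreal (c * h k powr (\<gamma> - d)) * indicator (A (h k)) x) \<partial>M)"
  proof (rule nn_integral_mono)
    fix x assume "x \<in> space M"
    show "ennreal (w x powr (\<gamma> - d)) * indicator (A \<rho>) x
        \<le> (\<Sum>k. ennreal (c * h k powr (\<gamma> - d)) * indicator (A (h k)) x)"
    proof (cases "x \<in> A \<rho>")
      case True
      then obtain k where k: "h k / 2 \<le> w x" "w x < h k"
        using dyadic_layer[of "w x" \<rho>] by (auto simp: A_def h_def)
      have term_le: "g k \<le> suminf g" for g :: "nat \<Rightarrow> ennreal"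
        using sum_le_suminf[of g "{k}"] by simp
      have "ennreal (w x powr (\<gamma> - d)) * indicator (A \<rho>) x
          \<le> ennreal (c * h k powr (\<gamma> - d)) * indicator (A (h k)) x"
        using True k powr_le_comparable[OF h k(1), of "\<gamma> - d"]
        by (auto simp: A_def c_def intro!: ennreal_leI)
      also have "\<dots> \<le> (\<Sum>k. ennreal (c * h k powr (\<gamma> - d)) * indicator (A (h k)) x)"
        by (rule term_le)
      finally show ?thesis .
    qed simp
  qed
  also have "\<dots> = (\<Sum>k. \<integral>\<^sup>+x. ennreal (c * h k powr (\<gamma> - d)) * indicator (A (h k)) x \<partial>M)"
    by (rule nn_integral_suminf) measurable
  also have "\<dots> = (\<Sum>k. ennreal (c * h k powr (\<gamma> - d)) * emeasure M (A (h k)))"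
    by (subst nn_integral_cmult_indicator) auto
  also have "\<dots> \<le> (\<Sum>k. ennreal (c * C * \<rho> powr \<gamma> * (2 powr - \<gamma>) ^ k))"
  proof (rule suminf_le)
    fix k
    have "ennreal (c * h k powr (\<gamma> - d)) * emeasure M (A (h k))
        \<le> ennreal (c * h k powr (\<gamma> - d)) * ennreal (C * h k powr d)"
      unfolding A_def by (intro mult_left_mono vol h) auto
    also have "\<dots> = ennreal (c * C * h k powr \<gamma>)"
      using c \<open>0 \<le> C\<close> h[of k] by (simp add: ennreal_mult'[symmetric] powr_diff)
    also have "h k powr \<gamma> = \<rho> powr \<gamma> * (2 powr - \<gamma>) ^ k"
      using \<open>0 < \<rho>\<close> by (simp add: h_def powr_mult powr_powr powr_realpow[symmetric] mult.commute)
    finally show "ennreal (c * h k powr (\<gamma> - d)) * emeasure M (A (h k))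
        \<le> ennreal (c * C * \<rho> powr \<gamma> * (2 powr - \<gamma>) ^ k)" by (simp add: mult_ac)
  qed auto
  also have "\<dots> = ennreal (\<Sum>k. c * C * \<rho> powr \<gamma> * (2 powr - \<gamma>) ^ k)"
    using c \<open>0 \<le> C\<close> q by (intro suminf_ennreal2 summable_mult summable_geometric) auto
  also have "(\<Sum>k. c * C * \<rho> powr \<gamma> * (2 powr - \<gamma>) ^ k) = c * C * \<rho> powr \<gamma> * (1 / (1 - 2 powr - \<gamma>))"
    using q by (subst suminf_mult) (auto simp: suminf_geometric)
  finally show ?thesis by (simp add: A_def c_def)
qed

text \<open>Balls of radius \<open>h\<close> have volume proportional to
  \<open>h powr real DIM('a)\<close>, so the dyadic estimate applies. The point of the form chosen
  is that \<open>K\<close> depends on neither the center nor the radius.\<close>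

lemma nn_integral_norm_powr_le:
  fixes \<gamma> :: real
  assumes "0 < \<gamma>"
  obtains K where "0 \<le> K" "\<And>(x::'a::euclidean_space) \<rho>. 0 < \<rho> \<Longrightarrow>
    (\<integral>\<^sup>+y\<in>ball x \<rho>. ennreal (norm (y - x) powr (\<gamma> - real DIM('a))) \<partial>lborel) \<le> ennreal (K * \<rho> powr \<gamma>)"
proof
  define C where "C = 2 powr \<bar>\<gamma> - real DIM('a)\<bar> / (1 - 2 powr - \<gamma>)"
  define B where "B = unit_ball_vol (real DIM('a))"
  have B: "B \<ge> 0" by (simp add: B_def)
  have "2 powr - \<gamma> < (1::real)" using \<open>0 < \<gamma>\<close> by (simp add: powr_less_one)
  then show "0 \<le> C * B" using B by (simp add: C_def)
  fix x :: 'a and \<rho> :: real assume "0 < \<rho>"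
  \<comment> \<open>The center can be removed because \<open>0 powr e = 0\<close> for every
    exponent.\<close>
  have "(\<integral>\<^sup>+y\<in>ball x \<rho>. ennreal (norm (y - x) powr (\<gamma> - real DIM('a))) \<partial>lborel)
      = (\<integral>\<^sup>+y\<in>{y \<in> UNIV. 0 < norm (y - x) \<and> norm (y - x) < \<rho>}.
          ennreal (norm (y - x) powr (\<gamma> - real DIM('a))) \<partial>lborel)"
    by (intro nn_integral_cong) (auto simp: indicator_def dist_norm norm_minus_commute)
  also have "\<dots> \<le> ennreal (C * B * \<rho> powr \<gamma>)"
    unfolding C_def
  proof (rule nn_integral_powr_le)
    fix h :: real assume "0 < h"
    have "emeasure lborel {y \<in> UNIV. 0 < norm (y - x) \<and> norm (y - x) < h} \<le> emeasure lborel (ball x h)"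
      by (intro emeasure_mono) (auto simp: dist_norm norm_minus_commute)
    also have "\<dots> = ennreal (B * h powr real DIM('a))"
      using \<open>0 < h\<close> by (simp add: emeasure_ball B_def powr_realpow)
    finally show "emeasure lborel {y \<in> UNIV. 0 < norm (y - x) \<and> norm (y - x) < h}
      \<le> ennreal (B * h powr real DIM('a))" .
  qed (use B \<open>0 < \<rho>\<close> \<open>0 < \<gamma>\<close> in auto)
  finally show "(\<integral>\<^sup>+y\<in>ball x \<rho>. ennreal (norm (y - x) powr (\<gamma> - real DIM('a))) \<partial>lborel)
    \<le> ennreal (C * B * \<rho> powr \<gamma>)" .
qed

lemma emeasure_lborel_Times:
  fixes A :: "'a::euclidean_space set" and B :: "'b::euclidean_space set"
  assumes "A \<in> sets borel" "B \<in> sets borel"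
  shows "emeasure lborel (A \<times> B) = emeasure lborel A * emeasure lborel B"
  unfolding lborel_prod[symmetric] using assms
  by (intro lborel.emeasure_pair_measure_Times) auto

text \<open>The part of the cylinder of height less than \<open>h\<close> has measure
  \<open>C * h\<close>, so the dyadic estimate applies with \<open>d = 1\<close> and
  \<open>\<gamma> = e + 1 > 0\<close>.\<close>

lemma nn_integral_slab_powr_finite:
  fixes V :: "'a::euclidean_space set" and a b e :: real
  assumes "open V" "bounded V" "a < b" "-1 < e"
  shows "(\<integral>\<^sup>+x\<in>V \<times> {a<..<b}. ennreal ((snd x - a) powr e) \<partial>lborel) < \<infinity>"
proof -
  have [measurable]: "V \<in> sets borel" using \<open>open V\<close> by simp
  have fin: "emeasure lborel V < \<infinity>" using \<open>bounded V\<close> by (rule emeasure_bounded_finite)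
  define C where "C = measure lborel V"
  have C: "emeasure lborel V = ennreal C"
    using fin by (simp add: C_def emeasure_eq_ennreal_measure)
  have "(\<integral>\<^sup>+x\<in>V \<times> {a<..<b}. ennreal ((snd x - a) powr e) \<partial>lborel)
      = (\<integral>\<^sup>+x\<in>{x \<in> V \<times> UNIV. 0 < snd x - a \<and> snd x - a < b - a}.
           ennreal ((snd x - a) powr ((e + 1) - 1)) \<partial>lborel)"
    by (intro nn_integral_cong) (auto simp: indicator_def)
  also have "\<dots> \<le> ennreal (2 powr \<bar>(e + 1) - 1\<bar> / (1 - 2 powr - (e + 1)) * C * (b - a) powr (e + 1))"
  proof (rule nn_integral_powr_le)
    show "V \<times> UNIV \<in> sets (lborel :: ('a \<times> real) measure)"
      using \<open>open V\<close> by (simp add: borel_open open_Times)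
    fix h :: real assume "0 < h"
    have "{x \<in> V \<times> UNIV. 0 < snd x - a \<and> snd x - a < h} = V \<times> {a<..<a + h}" by auto
    then show "emeasure lborel {x \<in> V \<times> UNIV. 0 < snd x - a \<and> snd x - a < h} \<le> ennreal (C * h powr 1)"
      using \<open>0 < h\<close> by (simp add: emeasure_lborel_Times C ennreal_mult' C_def)
  qed (use assms in \<open>auto simp: C_def borel_prod[symmetric]\<close>)
  also have "\<dots> < \<infinity>" by simp
  finally show ?thesis .
qed


section \<open>Pointwise bounds on the kernel of the power function\<close>

text \<open>Mean value theorem on the half-line from \<open>t / 2\<close>, where the derivative is
  largest in modulus at the left end. Hence \<open>u\<close> may lie arbitrarily far above
  \<open>t\<close>.\<close>

lemma powr_minus_lipschitz:
  fixes t u \<beta> :: real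
  assumes "0 < t" "t / 2 \<le> u" "0 < \<beta>"
  shows "\<bar>u powr - \<beta> - t powr - \<beta>\<bar> \<le> \<beta> * (t / 2) powr (- \<beta> - 1) * \<bar>u - t\<bar>"
proof -
  have "norm (u powr - \<beta> - t powr - \<beta>) \<le> \<beta> * (t / 2) powr (- \<beta> - 1) * norm (u - t)"
  proof (rule field_differentiable_bound)
    show "convex {t / 2..}" by simp
    fix z assume z: "z \<in> {t / 2..}"
    with assms have "z > 0" by auto
    then show "((\<lambda>z. z powr - \<beta>) has_field_derivative - \<beta> * z powr (- \<beta> - 1)) (at z within {t / 2..})"
      by (rule has_field_derivative_at_within[OF has_real_derivative_powr])
    have "z powr (- \<beta> - 1) \<le> (t / 2) powr (- \<beta> - 1)"
      using z assms by (intro powr_mono2') auto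
    then show "norm (- \<beta> * z powr (- \<beta> - 1)) \<le> \<beta> * (t / 2) powr (- \<beta> - 1)"
      using assms by (simp add: abs_mult)
  qed (use assms in auto)
  then show ?thesis by simp
qed

text \<open>The Lipschitz bound supplies a factor \<open>norm (y - x) powr p\<close>, which leaves a
  singularity of exponent above minus the dimension when \<open>s < 1\<close>.\<close>

lemma gagliardo_kernel_near:
  fixes x y :: "'a::euclidean_space \<times> real" and a s p \<beta> :: real
  assumes "0 < snd x - a" "(snd x - a) / 2 \<le> snd y - a" "0 < \<beta>" "0 < p"
  shows "gagliardo_kernel s p (\<lambda>x. (snd x - a) powr - \<beta>) x y
    \<le> (\<beta> * 2 powr (\<beta> + 1)) powr p * (snd x - a) powr (- ((\<beta> + 1) * p))
      * norm (y - x) powr (p * (1 - s) - real DIM('a \<times> real))"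
proof (cases "y = x")
  case True
  then show ?thesis by (simp add: gagliardo_kernel_def)
next
  case False
  define t where "t = snd x - a"
  have t: "t > 0" using assms by (simp add: t_def)
  have scale: "(t / 2) powr - e = 2 powr e * t powr - e" for e
    using t by (simp add: powr_divide powr_minus field_simps)
  have "\<bar>(snd y - a) powr - \<beta> - t powr - \<beta>\<bar> \<le> \<beta> * (t / 2) powr (- \<beta> - 1) * \<bar>(snd y - a) - t\<bar>"
    using assms by (intro powr_minus_lipschitz) (auto simp: t_def)
  also have "\<bar>(snd y - a) - t\<bar> \<le> norm (y - x)"
    using dist_snd_le[of y x] by (simp add: t_def dist_norm)
  finally have "\<bar>(snd y - a) powr - \<beta> - t powr - \<beta>\<bar> \<le> \<beta> * (t / 2) powr (- \<beta> - 1) * norm (y - x)"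
    using assms by (simp add: mult_left_mono)
  then have "\<bar>(snd y - a) powr - \<beta> - t powr - \<beta>\<bar> powr p
      \<le> (\<beta> * (t / 2) powr (- \<beta> - 1) * norm (y - x)) powr p"
    using assms by (intro powr_mono2) auto
  also have "(t / 2) powr (- \<beta> - 1) = 2 powr (\<beta> + 1) * t powr (- (\<beta> + 1))"
    using scale[of "\<beta> + 1"] by simp
  also have "(\<beta> * (2 powr (\<beta> + 1) * t powr (- (\<beta> + 1))) * norm (y - x)) powr p
      = (\<beta> * 2 powr (\<beta> + 1)) powr p * t powr (- ((\<beta> + 1) * p)) * norm (y - x) powr p"
    using assms t by (simp add: powr_mult powr_powr algebra_simps)
  finally have le: "\<bar>(snd y - a) powr - \<beta> - t powr - \<beta>\<bar> powr p
    \<le> (\<beta> * 2 powr (\<beta> + 1)) powr p * t powr (- ((\<beta> + 1) * p)) * norm (y - x) powr p" .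
  have "norm (y - x) powr (p * (1 - s) - real DIM('a \<times> real))
      = norm (y - x) powr p / norm (y - x) powr (s * p + real DIM('a \<times> real))"
    unfolding powr_diff[symmetric] by (simp add: algebra_simps)
  then show ?thesis
    using divide_right_mono[OF le, of "norm (y - x) powr (s * p + real DIM('a \<times> real))"]
    by (simp add: gagliardo_kernel_def t_def)
qed

text \<open>With \<open>y\<close> the lower point, the difference of the two values is at most the
  value at \<open>y\<close>. The resulting bound depends on \<open>y\<close> alone and is integrable
  over the cylinder when \<open>\<beta> * p < 1\<close>.\<close>

lemma gagliardo_kernel_far:
  fixes x y :: "'a::euclidean_space \<times> real" and a s p \<beta> c :: real
  assumes "0 < snd y - a" "snd y - a \<le> snd x - a" "0 < c" "c \<le> norm (y - x)"
    "0 < \<beta>" "0 < p" "0 < s"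
  shows "gagliardo_kernel s p (\<lambda>x. (snd x - a) powr - \<beta>) x y
    \<le> c powr (- (s * p + real DIM('a \<times> real))) * (snd y - a) powr (- (\<beta> * p))"
proof -
  have "(snd x - a) powr - \<beta> \<le> (snd y - a) powr - \<beta>"
    using assms by (intro powr_mono2') auto
  then have "\<bar>(snd y - a) powr - \<beta> - (snd x - a) powr - \<beta>\<bar> powr p \<le> ((snd y - a) powr - \<beta>) powr p"
    using assms by (intro powr_mono2) auto
  moreover have "c powr (s * p + real DIM('a \<times> real)) \<le> norm (y - x) powr (s * p + real DIM('a \<times> real))"
    using assms by (intro powr_mono2) auto
  ultimately have "gagliardo_kernel s p (\<lambda>x. (snd x - a) powr - \<beta>) x y
    \<le> ((snd y - a) powr - \<beta>) powr p / c powr (s * p + real DIM('a \<times> real))"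
    unfolding gagliardo_kernel_def using assms by (intro frac_le) auto
  also have "\<dots> = c powr (- (s * p + real DIM('a \<times> real))) * (snd y - a) powr (- (\<beta> * p))"
    by (simp only: powr_powr mult_minus_left powr_minus[of c] divide_inverse) (rule mult.commute)
  finally show ?thesis .
qed

section \<open>Finiteness of the screened energy\<close>

lemma power_screened_energy_finite:
  fixes V :: "'a::euclidean_space set" and a b s p r \<beta> :: real
  assumes V: "open V" "bounded V" and "a < b" "0 < p" "0 < s" "s < 1"
    and r: "1 / (1 - s) < r" and \<beta>: "0 < \<beta>" "\<beta> * p < 1"
    and U: "U = V \<times> {a<..<b}"
    and \<sigma>: "\<And>x. x \<in> U \<Longrightarrow> \<sigma> x = ereal (1 / 2 * ((snd x - a) / (b - a)) powr r)"
  shows "(\<integral>\<^sup>+x\<in>U. (\<integral>\<^sup>+y\<in>eball x (\<sigma> x) \<inter> U.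
      ennreal (gagliardo_kernel s p (\<lambda>x. (snd x - a) powr - \<beta>) x y) \<partial>lebesgue) \<partial>lebesgue) < \<infinity>"
proof -
  define L where "L = b - a"
  have L: "L > 0" using \<open>a < b\<close> by (simp add: L_def)
  define \<gamma> where "\<gamma> = p * (1 - s)"
  have \<gamma>: "\<gamma> > 0" using assms by (simp add: \<gamma>_def)
  have rs: "1 < r * (1 - s)" using r \<open>s < 1\<close> by (simp add: field_simps)
  have "1 < r"
  proof -
    have "1 \<le> 1 / (1 - s)" using \<open>0 < s\<close> \<open>s < 1\<close> by simp
    with r show ?thesis by linarith
  qed
  \<comment> \<open>The surplus power of the height left after integrating the near bound over the
    screening ball; being nonnegative, it is bounded by a constant on \<open>U\<close>.\<close>
  have gap: "0 \<le> r * \<gamma> - p"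
    using mult_left_mono[of 1 "r * (1 - s)" p] rs \<open>0 < p\<close> by (simp add: \<gamma>_def algebra_simps)
  define N where "N = real DIM('a \<times> real)"
  obtain K where K: "0 \<le> K" "\<And>(x::'a \<times> real) \<rho>. 0 < \<rho> \<Longrightarrow>
    (\<integral>\<^sup>+y\<in>ball x \<rho>. ennreal (norm (y - x) powr (\<gamma> - N)) \<partial>lborel) \<le> ennreal (K * \<rho> powr \<gamma>)"
    unfolding N_def using nn_integral_norm_powr_le[OF \<gamma>, where 'a = "'a \<times> real"] by blast
  define g where "g = (\<lambda>x::'a \<times> real. (snd x - a) powr (- (\<beta> * p)))"
  have g[measurable]: "g \<in> borel_measurable borel"
    unfolding g_def borel_prod[symmetric] by measurable
  have "open U" using V unfolding U by (intro open_Times) auto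
  then have [measurable]: "U \<in> sets borel" by simp
  define I where "I = (\<integral>\<^sup>+x\<in>U. ennreal (g x) \<partial>lborel)"
  have I: "I < \<infinity>"
    unfolding I_def U g_def using assms by (intro nn_integral_slab_powr_finite) auto
  have U_fin: "emeasure lborel U < \<infinity>"
    unfolding U using V by (intro emeasure_bounded_finite bounded_Times) auto
  \<comment> \<open>If the ball of a point of height \<open>t\<close> reaches below
    \<open>t / 2\<close>, then \<open>t / 2\<close> is less than its radius, that is
    \<open>t < (t / L) powr r\<close>. As \<open>r > 1\<close>, this forces
    \<open>t > 2 * c\<close>, so such pairs are more than \<open>c\<close> apart.\<close>
  define c where "c = L powr (r / (r - 1)) / 2"
  have c: "c > 0" using L by (simp add: c_def)
  define C1 where "C1 = (\<beta> * 2 powr (\<beta> + 1)) powr p"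
  define C2 where "C2 = c powr (- (s * p + N))"
  define C3 where "C3 = C1 * K * (2 * L powr r) powr (- \<gamma>) * L powr (r * \<gamma> - p)"
  let ?k = "gagliardo_kernel s p (\<lambda>x::'a \<times> real. (snd x - a) powr - \<beta>)"
  have inner: "(\<integral>\<^sup>+y\<in>eball x (\<sigma> x) \<inter> U. ennreal (?k x y) \<partial>lborel) \<le> ennreal (C3 * g x) + ennreal C2 * I"
    if x: "x \<in> U" for x
  proof -
    define t where "t = snd x - a"
    have t: "0 < t" "t < L" using x by (auto simp: U t_def L_def)
    define \<rho> where "\<rho> = 1 / 2 * (t / L) powr r"
    have \<rho>: "\<rho> > 0" using t L by (simp add: \<rho>_def)
    have \<sigma>x: "\<sigma> x = ereal \<rho>" using \<sigma>[OF x] by (simp add: \<rho>_def t_def L_def)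
    have [measurable]: "ball x \<rho> \<in> sets borel" by simp
    define D where "D = C1 * t powr (- ((\<beta> + 1) * p))"
    have D: "D \<ge> 0" by (simp add: D_def C1_def)
    \<comment> \<open>Adding the near and far bounds gives one majorant for every \<open>y\<close>,
      so the domain of integration need not be split.\<close>
    have bound: "?k x y \<le> D * norm (y - x) powr (\<gamma> - N) + C2 * g y"
      if y: "y \<in> U" and yx: "dist x y < \<rho>" for y
    proof (cases "t / 2 \<le> snd y - a")
      case True
      then have "?k x y \<le> D * norm (y - x) powr (\<gamma> - N)"
        unfolding D_def C1_def \<gamma>_def N_def t_def
        using t assms by (intro gagliardo_kernel_near) (auto simp: t_def)
      also have "\<dots> \<le> D * norm (y - x) powr (\<gamma> - N) + C2 * g y"
        by (simp add: C2_def g_def)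
      finally show ?thesis .
    next
      case False
      have "t / 2 < \<bar>snd y - snd x\<bar>" using False t by (auto simp: t_def)
      also have "\<dots> \<le> norm (y - x)"
        using dist_snd_le[of y x] by (simp add: dist_norm)
      finally have far: "t / 2 < norm (y - x)" .
      also have "\<dots> < \<rho>" using yx by (simp add: dist_norm norm_minus_commute)
      finally have "t < (t / L) powr r" by (simp add: \<rho>_def)
      then have "L powr r < t powr (r - 1)"
        using t L by (simp add: powr_divide powr_diff field_simps)
      then have "(L powr r) powr (1 / (r - 1)) < (t powr (r - 1)) powr (1 / (r - 1))"
        using \<open>1 < r\<close> L by (intro powr_less_mono2) auto
      then have "2 * c < t" using \<open>1 < r\<close> t by (simp add: powr_powr c_def)
      with far have "c \<le> norm (y - x)" by simp
      then have "?k x y \<le> C2 * g y"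
        unfolding C2_def g_def N_def
        using y c False t assms by (intro gagliardo_kernel_far) (auto simp: U t_def)
      also have "\<dots> \<le> D * norm (y - x) powr (\<gamma> - N) + C2 * g y"
        using D by simp
      finally show ?thesis .
    qed
    have "(\<integral>\<^sup>+y\<in>eball x (\<sigma> x) \<inter> U. ennreal (?k x y) \<partial>lborel)
        \<le> (\<integral>\<^sup>+y. ennreal D * (ennreal (norm (y - x) powr (\<gamma> - N)) * indicator (ball x \<rho>) y)
              + ennreal C2 * (ennreal (g y) * indicator U y) \<partial>lborel)"
    proof (rule nn_integral_mono)
      fix y
      show "ennreal (?k x y) * indicator (eball x (\<sigma> x) \<inter> U) y
        \<le> ennreal D * (ennreal (norm (y - x) powr (\<gamma> - N)) * indicator (ball x \<rho>) y)
              + ennreal C2 * (ennreal (g y) * indicator U y)"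
      proof (cases "y \<in> U \<and> dist x y < \<rho>")
        case True
        then have "ennreal (?k x y) \<le> ennreal (D * norm (y - x) powr (\<gamma> - N) + C2 * g y)"
          using bound by (intro ennreal_leI) auto
        also have "\<dots> = ennreal D * ennreal (norm (y - x) powr (\<gamma> - N)) + ennreal C2 * ennreal (g y)"
          using D by (simp add: ennreal_mult C2_def g_def)
        finally show ?thesis using True by (simp add: \<sigma>x eball_def)
      qed (auto simp: \<sigma>x eball_def)
    qed
    also have "\<dots> = ennreal D * (\<integral>\<^sup>+y\<in>ball x \<rho>. ennreal (norm (y - x) powr (\<gamma> - N)) \<partial>lborel) + ennreal C2 * I"
      unfolding I_def by (subst nn_integral_add) (auto simp: nn_integral_cmult)
    also have "\<dots> \<le> ennreal D * ennreal (K * \<rho> powr \<gamma>) + ennreal C2 * I"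
      by (intro add_right_mono mult_left_mono K \<rho>) auto
    also have "ennreal D * ennreal (K * \<rho> powr \<gamma>) = ennreal (D * (K * \<rho> powr \<gamma>))"
      using D K by (simp add: ennreal_mult)
    also have "\<dots> \<le> ennreal (C3 * g x)"
    proof (rule ennreal_leI)
      have "\<rho> = t powr r / (2 * L powr r)" using t L by (simp add: \<rho>_def powr_divide)
      then have "\<rho> powr \<gamma> = t powr (r * \<gamma>) * (2 * L powr r) powr (- \<gamma>)"
        using t L by (simp add: powr_divide powr_powr powr_minus_divide)
      then have "D * (K * \<rho> powr \<gamma>)
          = C1 * K * (2 * L powr r) powr (- \<gamma>) * (t powr (- ((\<beta> + 1) * p)) * t powr (r * \<gamma>))"
        by (simp add: D_def)
      \<comment> \<open>The loss \<open>t powr (- p)\<close> from differentiating is absorbed by the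
        smallness of the screening radius.\<close>
      also have "t powr (- ((\<beta> + 1) * p)) * t powr (r * \<gamma>) = t powr (r * \<gamma> - p) * g x"
        unfolding g_def t_def[symmetric] powr_add[symmetric] by (simp add: algebra_simps)
      finally have eq: "D * (K * \<rho> powr \<gamma>)
          = C1 * K * (2 * L powr r) powr (- \<gamma>) * (t powr (r * \<gamma> - p) * g x)" .
      have "t powr (r * \<gamma> - p) * g x \<le> L powr (r * \<gamma> - p) * g x"
        using t gap by (intro mult_right_mono powr_mono2) (auto simp: g_def)
      moreover have "0 \<le> C1 * K * (2 * L powr r) powr (- \<gamma>)"
        using K by (simp add: C1_def)
      ultimately show "D * (K * \<rho> powr \<gamma>) \<le> C3 * g x"
        unfolding eq C3_def mult.assoc[of _ "L powr _"] by (rule mult_left_mono)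
    qed
    finally show ?thesis by (simp add: add_right_mono)
  qed
  \<comment> \<open>Completing the measure does not change the integral, so the Borel estimates
    carry over to \<open>lebesgue\<close>.\<close>
  have "(\<integral>\<^sup>+x\<in>U. (\<integral>\<^sup>+y\<in>eball x (\<sigma> x) \<inter> U. ennreal (?k x y) \<partial>lebesgue) \<partial>lebesgue)
      = (\<integral>\<^sup>+x\<in>U. (\<integral>\<^sup>+y\<in>eball x (\<sigma> x) \<inter> U. ennreal (?k x y) \<partial>lborel) \<partial>lborel)"
    by (simp add: nn_integral_completion)
  also have "\<dots> \<le> (\<integral>\<^sup>+x. ennreal C3 * (ennreal (g x) * indicator U x)
      + ennreal C2 * I * indicator U x \<partial>lborel)"
  proof (rule nn_integral_mono)
    fix x
    have "C3 \<ge> 0" using K by (simp add: C3_def C1_def)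
    then show "(\<integral>\<^sup>+y\<in>eball x (\<sigma> x) \<inter> U. ennreal (?k x y) \<partial>lborel) * indicator U x
      \<le> ennreal C3 * (ennreal (g x) * indicator U x) + ennreal C2 * I * indicator U x"
      using inner[of x] by (cases "x \<in> U") (auto simp: ennreal_mult' g_def)
  qed
  also have "\<dots> = ennreal C3 * I + ennreal C2 * I * emeasure lborel U"
    by (subst nn_integral_add) (auto simp: nn_integral_cmult nn_integral_cmult_indicator I_def)
  also have "\<dots> < \<infinity>"
    using I U_fin by (auto simp: ennreal_mult_less_top)
  finally show ?thesis .
qed

section \<open>Divergence of the unscreened energy\<close>

text \<open>Only pairs from two thin slabs are counted: \<open>x\<close> at height between \<delta>
  and 2\<delta>, \<open>y\<close> between 3\<delta> and 4\<delta> and horizontally within \<delta>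
  of \<open>x\<close>. The values differ by at least a multiple of
  \<open>\<delta> powr - \<beta>\<close> and the distance is at most 4\<delta>. The slab of
  \<open>x\<close> has fixed width \<open>R\<close>, hence measure of order \<delta>, while
  \<open>y\<close> ranges over a set of measure of order
  \<open>\<delta> powr (n + 1)\<close>.\<close>

lemma power_gagliardo_energy_ge:
  fixes V :: "'a::euclidean_space set" and a b s p \<beta> :: real
  assumes "open V" "V \<noteq> {}" "a < b" "0 < p" "0 < s" "0 < \<beta>"
  obtains c \<delta>0 where "0 < c" "0 < \<delta>0" "\<And>\<delta>. \<lbrakk>0 < \<delta>; \<delta> < \<delta>0\<rbrakk> \<Longrightarrow>
    ennreal (c * \<delta> powr (1 - (\<beta> + s) * p))
      \<le> (\<integral>\<^sup>+x\<in>V \<times> {a<..<b}. (\<integral>\<^sup>+y\<in>V \<times> {a<..<b}.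
          ennreal (gagliardo_kernel s p (\<lambda>x. (snd x - a) powr - \<beta>) x y) \<partial>lborel) \<partial>lborel)"
proof -
  define f where "f = (\<lambda>x::'a \<times> real. (snd x - a) powr - \<beta>)"
  define U where "U = V \<times> {a<..<b}"
  obtain v where "v \<in> V" using \<open>V \<noteq> {}\<close> by auto
  then obtain R' where "R' > 0" "ball v R' \<subseteq> V"
    using \<open>open V\<close> openE by blast
  \<comment> \<open>Halving leaves room in \<open>V\<close> for the balls of radius \<delta> <
    \<open>R\<close> around points of \<open>ball v R\<close>.\<close>
  define R where "R = R' / 2"
  have R: "R > 0" using \<open>R' > 0\<close> by (simp add: R_def)
  have ball: "z \<in> V" if "dist v u < R" "dist u z < R" for u z
  proof -
    have "dist v z < R'" using that dist_triangle[of v z u] by (simp add: R_def)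
    then show ?thesis using \<open>ball v R' \<subseteq> V\<close> by auto
  qed
  define n where "n = real DIM('a)"
  have DIM: "real DIM('a \<times> real) = n + 1" by (simp add: n_def)
  define B where "B = unit_ball_vol n"
  have B: "B > 0" by (simp add: B_def n_def)
  define q where "q = s * p + real DIM('a \<times> real)"
  \<comment> \<open>The drop of the power function between heights 2\<delta> and 3\<delta>, after
    scaling out \<open>\<delta> powr - \<beta>\<close>.\<close>
  define c0 where "c0 = 2 powr - \<beta> - 3 powr - \<beta>"
  have "3 powr - \<beta> < 2 powr - \<beta>" using \<open>0 < \<beta>\<close> by (intro powr_less_mono2_neg) auto
  then have c0: "c0 > 0" by (simp add: c0_def)
  define c where "c = c0 powr p * 4 powr - q * B * (B * R powr n)"
  have "c > 0" using c0 B R by (simp add: c_def)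
  \<comment> \<open>The second entry keeps the upper slab, which ends at height 4\<delta>, below the
    top face.\<close>
  moreover have "0 < min R ((b - a) / 4)" using R \<open>a < b\<close> by simp
  moreover have "ennreal (c * \<delta> powr (1 - (\<beta> + s) * p))
      \<le> (\<integral>\<^sup>+x\<in>U. (\<integral>\<^sup>+y\<in>U. ennreal (gagliardo_kernel s p f x y) \<partial>lborel) \<partial>lborel)"
    if \<delta>: "0 < \<delta>" "\<delta> < min R ((b - a) / 4)" for \<delta>
  proof -
    define A where "A = ball v R \<times> {a + \<delta><..<a + 2 * \<delta>}"
    define D where "D x = ball (fst x) \<delta> \<times> {a + 3 * \<delta><..<a + 4 * \<delta>}" for x :: "'a \<times> real"
    define m where "m = (c0 * \<delta> powr - \<beta>) powr p / (4 * \<delta>) powr q"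
    have m: "m \<ge> 0" by (simp add: m_def)
    have vol: "emeasure lborel (ball u h \<times> {d<..<e}) = ennreal (B * h powr n * \<delta>)"
      if "h > 0" "e = d + \<delta>" for u :: 'a and h d e
      using that \<delta> B
      by (simp add: emeasure_lborel_Times emeasure_ball B_def n_def powr_realpow ennreal_mult')
    have volA: "emeasure lborel A = ennreal (B * R powr n * \<delta>)"
      using vol[of R "a + 2 * \<delta>" "a + \<delta>" v] R by (simp add: A_def)
    have volD: "emeasure lborel (D x) = ennreal (B * \<delta> powr n * \<delta>)" for x
      using vol[of \<delta> "a + 4 * \<delta>" "a + 3 * \<delta>" "fst x"] \<delta> by (simp add: D_def)
    have [measurable]: "A \<in> sets borel" "D x \<in> sets borel" for x
      unfolding A_def D_def by (auto intro!: borel_open open_Times)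
    have ker: "m \<le> gagliardo_kernel s p f x y" if x: "x \<in> A" and y: "y \<in> D x" for x y
    proof -
      have "(snd y - a) powr - \<beta> \<le> (3 * \<delta>) powr - \<beta>"
        using y \<delta> \<open>0 < \<beta>\<close> by (intro powr_mono2') (auto simp: D_def)
      moreover have "(2 * \<delta>) powr - \<beta> \<le> (snd x - a) powr - \<beta>"
        using x \<delta> \<open>0 < \<beta>\<close> by (intro powr_mono2') (auto simp: A_def)
      ultimately have "c0 * \<delta> powr - \<beta> \<le> \<bar>f y - f x\<bar>"
        using \<delta> by (simp add: f_def c0_def powr_mult algebra_simps)
      then have num: "(c0 * \<delta> powr - \<beta>) powr p \<le> \<bar>f y - f x\<bar> powr p"
        using c0 \<open>0 < p\<close> by (intro powr_mono2) auto
      have "norm (y - x) \<le> norm (fst (y - x)) + norm (snd (y - x))"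
        using norm_Pair_le[of "fst (y - x)" "snd (y - x)"] unfolding prod.collapse .
      also have "\<dots> \<le> \<delta> + 3 * \<delta>"
        using x y by (intro add_mono) (auto simp: A_def D_def dist_norm norm_minus_commute)
      finally have "norm (y - x) \<le> 4 * \<delta>" by simp
      then have den: "norm (y - x) powr q \<le> (4 * \<delta>) powr q"
        using \<open>0 < p\<close> \<open>0 < s\<close> by (intro powr_mono2) (auto simp: q_def)
      have "snd x < snd y" using x y \<delta> by (auto simp: A_def D_def)
      then have "norm (y - x) > 0" by auto
      then show ?thesis
        unfolding m_def gagliardo_kernel_def q_def[symmetric]
        using num den by (intro frac_le) auto
    qed
    have D_sub: "D x \<subseteq> U" if "x \<in> A" for x
      using that \<delta> ball by (auto simp: A_def D_def U_def)
    have inner: "ennreal (m * (B * \<delta> powr n * \<delta>))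
        \<le> (\<integral>\<^sup>+y\<in>U. ennreal (gagliardo_kernel s p f x y) \<partial>lborel)" if x: "x \<in> A" for x
    proof -
      have "ennreal (m * (B * \<delta> powr n * \<delta>)) = (\<integral>\<^sup>+y. ennreal m * indicator (D x) y \<partial>lborel)"
        using m by (simp add: nn_integral_cmult_indicator volD ennreal_mult')
      also have "\<dots> \<le> (\<integral>\<^sup>+y\<in>U. ennreal (gagliardo_kernel s p f x y) \<partial>lborel)"
        using D_sub[OF x] ker[OF x]
        by (intro nn_integral_mono) (auto simp: indicator_def intro!: ennreal_leI)
      finally show ?thesis .
    qed
    have "A \<subseteq> U"
    proof
      fix x assume "x \<in> A"
      then have "fst x \<in> V" using ball[of "fst x" "fst x"] R by (auto simp: A_def)
      then show "x \<in> U" using \<open>x \<in> A\<close> \<delta> by (auto simp: A_def U_def)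
    qed
    \<comment> \<open>In the exponent of \<delta>, the volume \<open>n + 1\<close> of
      \<open>D x\<close> cancels the dimension in \<open>q\<close>; the remaining 1 is the thickness
      of \<open>A\<close>.\<close>
    have "c * \<delta> powr (1 - (\<beta> + s) * p) = m * (B * \<delta> powr n * \<delta>) * (B * R powr n * \<delta>)"
    proof -
      have num_eq: "(c0 * \<delta> powr - \<beta>) powr p = c0 powr p * \<delta> powr (- (\<beta> * p))"
        using c0 by (simp add: powr_mult powr_powr)
      have den_eq: "inverse ((4 * \<delta>) powr q) = 4 powr - q * \<delta> powr - q"
        using \<delta> by (simp add: powr_mult flip: powr_minus)
      have "m = c0 powr p * 4 powr - q * (\<delta> powr (- (\<beta> * p)) * \<delta> powr - q)"
        unfolding m_def divide_inverse num_eq den_eq by (simp only: mult_ac)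
      moreover have "\<delta> powr (1 - (\<beta> + s) * p)
          = (\<delta> powr (- (\<beta> * p)) * \<delta> powr - q) * (\<delta> powr n * \<delta> powr 1) * \<delta> powr 1"
        unfolding powr_add[symmetric] q_def DIM by (simp add: algebra_simps)
      ultimately show ?thesis using \<delta> by (simp add: c_def)
    qed
    then have "ennreal (c * \<delta> powr (1 - (\<beta> + s) * p))
        = (\<integral>\<^sup>+x. ennreal (m * (B * \<delta> powr n * \<delta>)) * indicator A x \<partial>lborel)"
      using m B \<delta> by (simp add: nn_integral_cmult_indicator volA ennreal_mult')
    also have "\<dots> \<le> (\<integral>\<^sup>+x\<in>U. (\<integral>\<^sup>+y\<in>U. ennreal (gagliardo_kernel s p f x y) \<partial>lborel) \<partial>lborel)"
      using \<open>A \<subseteq> U\<close> inner by (intro nn_integral_mono) (auto simp: indicator_def)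
    finally show ?thesis .
  qed
  ultimately show thesis
    unfolding f_def U_def by (rule that)
qed

lemma power_gagliardo_energy_infinite:
  fixes V :: "'a::euclidean_space set" and a b s p \<beta> :: real
  assumes "open V" "V \<noteq> {}" "a < b" "0 < p" "0 < s" "0 < \<beta>" and \<beta>: "1 < (\<beta> + s) * p"
  shows "(\<integral>\<^sup>+x\<in>V \<times> {a<..<b}. (\<integral>\<^sup>+y\<in>V \<times> {a<..<b}.
          ennreal (gagliardo_kernel s p (\<lambda>x. (snd x - a) powr - \<beta>) x y) \<partial>lebesgue) \<partial>lebesgue) = \<infinity>"
    (is "?E = _")
proof (rule ccontr)
  assume "?E \<noteq> \<infinity>"
  then obtain e where e: "0 \<le> e" "?E = ennreal e" by (cases ?E) auto
  obtain c \<delta>0 where c: "0 < c" "0 < \<delta>0" and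
    le: "\<And>\<delta>. \<lbrakk>0 < \<delta>; \<delta> < \<delta>0\<rbrakk> \<Longrightarrow> ennreal (c * \<delta> powr (1 - (\<beta> + s) * p)) \<le> ?E"
    using power_gagliardo_energy_ge[OF assms(1-6)] by (simp only: nn_integral_completion) blast
  define \<eta> where "\<eta> = (\<beta> + s) * p - 1"
  have \<eta>: "\<eta> > 0" using \<beta> by (simp add: \<eta>_def)
  define M where "M = (e + 1) / c"
  have M: "M > 0" using e c by (simp add: M_def)
  \<comment> \<open>Small enough that \<open>c * \<delta> powr - \<eta>\<close> is at least
    \<open>e + 1\<close>, above the supposed finite energy \<open>e\<close>.\<close>
  define \<delta> where "\<delta> = min (\<delta>0 / 2) (M powr (- 1 / \<eta>))"
  have \<delta>: "0 < \<delta>" "\<delta> < \<delta>0" using c M by (auto simp: \<delta>_def)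
  have "M = (M powr (- 1 / \<eta>)) powr - \<eta>" using M \<eta> by (simp add: powr_powr)
  also have "\<dots> \<le> \<delta> powr - \<eta>"
    using \<delta> \<eta> by (intro powr_mono2') (auto simp: \<delta>_def)
  finally have "e + 1 \<le> c * \<delta> powr - \<eta>"
    using c by (simp add: M_def field_simps)
  moreover have "c * \<delta> powr - \<eta> \<le> e"
    using le[OF \<delta>] e by (simp add: \<eta>_def)
  ultimately show False by simp
qed

section \<open>Inclusion of the spaces and choice of the exponent\<close>

lemma locally_integrable_continuous:
  assumes "continuous_on U f"
  shows "locally_integrable U f"
  unfolding locally_integrable_def
proof safe
  fix K assume K: "compact K" "K \<subseteq> U"
  have "integrable lborel (\<lambda>x. indicator K x *\<^sub>R f x)"
    using K assms by (intro borel_integrable_compact) (auto intro: continuous_on_subset)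
  then show "f absolutely_integrable_on K"
    unfolding set_integrable_def by (intro integrable_completion[THEN iffD2]) auto
qed

lemma homogeneous_subset_screened:
  "homogeneous_sobolev s p U \<subseteq> screened_sobolev s p \<sigma> U"
proof
  fix f assume f: "f \<in> homogeneous_sobolev s p U"
  have "(\<integral>\<^sup>+x\<in>U. (\<integral>\<^sup>+y\<in>eball x (\<sigma> x) \<inter> U. ennreal (gagliardo_kernel s p f x y) \<partial>lebesgue) \<partial>lebesgue)
      \<le> (\<integral>\<^sup>+x\<in>U. (\<integral>\<^sup>+y\<in>U. ennreal (gagliardo_kernel s p f x y) \<partial>lebesgue) \<partial>lebesgue)"
    by (intro nn_integral_mono mult_right_mono) (auto simp: indicator_def)
  also have "\<dots> < \<infinity>" using f by (simp add: homogeneous_sobolev_def)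
  finally show "f \<in> screened_sobolev s p \<sigma> U"
    using f by (simp add: homogeneous_sobolev_def screened_sobolev_def)
qed

theorem theorem3p13:
  fixes p s r a b :: real
    and V :: "(real ^ 'n) set"
    and U :: "((real ^ 'n) \<times> real) set"
    and \<sigma> :: "(real ^ 'n) \<times> real \<Rightarrow> ereal"
  assumes "1 \<le> p" and "0 < s" and "s < 1"
    and "1 / (1 - s) * (2 - 1 / p) < r"
    and "a < b"
    and "V \<noteq> {}" and "bounded V" and "open V"
    and "U = V \<times> {a<..<b}"
    and "\<And>x. x \<in> U \<Longrightarrow> \<sigma> x = ereal (1 / 2 * ((snd x - a) / (b - a)) powr r)"
  shows "homogeneous_sobolev s p U \<subset> screened_sobolev s p \<sigma> U"
proof -
  have "p > 0" using \<open>1 \<le> p\<close> by simp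
  \<comment> \<open>Half of this minimum is the amount by which \<beta> stays below
    \<open>1 / p\<close>: small enough to keep \<beta> positive and above
    \<open>1 / p - s\<close>.\<close>
  define m where "m = min s (1 / p)"
  have m: "0 < m" "m \<le> s" "m \<le> 1 / p"
    using \<open>0 < s\<close> \<open>p > 0\<close> by (auto simp: m_def)
  define \<epsilon> where "\<epsilon> = m / 2"
  have \<epsilon>: "0 < \<epsilon>" "\<epsilon> < s" "\<epsilon> < 1 / p"
    using m unfolding \<epsilon>_def by linarith+
  define \<beta> where "\<beta> = 1 / p - \<epsilon>"
  have "0 < \<beta>" using \<epsilon> by (simp add: \<beta>_def)
  have "\<beta> * p = 1 - \<epsilon> * p" "(\<beta> + s) * p = 1 + (s - \<epsilon>) * p"
    using \<open>p > 0\<close> by (auto simp: \<beta>_def field_simps)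
  then have \<beta>: "\<beta> * p < 1" "1 < (\<beta> + s) * p"
    using \<epsilon> \<open>p > 0\<close> by auto
  \<comment> \<open>As \<open>p \<ge> 1\<close> gives \<open>2 - 1 / p \<ge> 1\<close>, the
    hypothesis on \<open>r\<close> yields \<open>r * (1 - s) > 1\<close>.\<close>
  have "1 / (1 - s) * 1 \<le> 1 / (1 - s) * (2 - 1 / p)"
    using \<open>1 \<le> p\<close> \<open>s < 1\<close> by (intro mult_left_mono) auto
  then have r: "1 / (1 - s) < r" using assms(4) by simp
  define f where "f = (\<lambda>x::(real ^ 'n) \<times> real. (snd x - a) powr - \<beta>)"
  have "continuous_on U f"
    unfolding f_def by (intro continuous_intros) (auto simp: \<open>U = _\<close>)
  then have "locally_integrable U f" by (rule locally_integrable_continuous)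
  moreover have "(\<integral>\<^sup>+x\<in>U. (\<integral>\<^sup>+y\<in>eball x (\<sigma> x) \<inter> U.
      ennreal (gagliardo_kernel s p f x y) \<partial>lebesgue) \<partial>lebesgue) < \<infinity>"
    unfolding f_def
    by (rule power_screened_energy_finite[OF \<open>open V\<close> \<open>bounded V\<close> \<open>a < b\<close> \<open>p > 0\<close> \<open>0 < s\<close> \<open>s < 1\<close>
        r \<open>0 < \<beta>\<close> \<beta>(1) \<open>U = _\<close> assms(10)])
  ultimately have "f \<in> screened_sobolev s p \<sigma> U"
    by (simp add: screened_sobolev_def)
  moreover have "f \<notin> homogeneous_sobolev s p U"
    using power_gagliardo_energy_infinite[OF \<open>open V\<close> \<open>V \<noteq> {}\<close> \<open>a < b\<close> \<open>p > 0\<close> \<open>0 < s\<close> \<open>0 < \<beta>\<close> \<beta>(2)]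
    by (simp add: homogeneous_sobolev_def f_def \<open>U = _\<close>)
  ultimately show ?thesis
    using homogeneous_subset_screened[of s p U \<sigma>] by blast
qed

end
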